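(* Let $n\geq 3$ and let $X_1,\ldots,X_n$ be independent and identically distributed random variables taking values in the positive integers. Let $M_n=\max\{X_1,\ldots,X_n\}$ and $K_n=|\{i\in\{1,\ldots,n\}:X_i=M_n\}|$. Let $Y\sim\mathrm{Pois}(\lambda)$ have a Poisson distribution with parameter $\lambda=\mathbb{E}[(K_n)_2]/\mathbb{E}[K_n]$. Then $$d_{\mathrm{TV}}(K_n,Y)\leq\frac{\sqrt{\mathbb{E}[(K_n)_2]-\mathbb{E}[K_n](\mathbb{E}[K_n]-1)}}{2\mathbb{E}[K_n]}+\sqrt{\frac{\mathbb{E}[K_n]}{4\mathbb{E}[(K_n)_2]}}+\frac{(n-1)\mathbb{E}[(K_n)_3]}{(n-2)\mathbb{E}[(K_n)_2]}-\frac{(n-2)\mathbb{E}[(K_n)_2]}{(n-1)\mathbb{E}[K_n]}.$$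
   Context: $(k)_\ell=k(k-1)\cdots(k-\ell+1)$ denotes the falling factorial. $Y\sim\mathrm{Pois}(\lambda)$, $\lambda>0$, means $\mathbb{P}(Y=k)=e^{-\lambda}\lambda^k/k!$ for $k=0,1,\ldots$. For random variables $K,L$ supported on $\mathbb{Z}^+=\{0,1,2,\ldots\}$, the total variation distance is $d_{\mathrm{TV}}(K,L)=\sup_{E\subseteq\mathbb{Z}^+}|\mathbb{P}(K\in E)-\mathbb{P}(L\in E)|=\frac12\sum_{j\in\mathbb{Z}^+}|\mathbb{P}(K=j)-\mathbb{P}(L=j)|$. With $p(j)=\mathbb{P}(X_1=j)$ and $F(j)=\mathbb{P}(X_1\leq j)$, the probability mass function of $K_n$ is $\mathbb{P}(K_n=k)=\binom{n}{k}\sum_{j=1}^\infty p(j)^kF(j-1)^{n-k}$ for $k=1,\ldots,n$, with $F(0)=0$ and $0^0=1$. *)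

theory Defs
  imports "HOL-Probability.Probability"
begin

text \<open>The factor \<open>0\<close> makes this vanish for \<open>l > k\<close>; the subtraction is taken over the
  reals, so no truncation is involved.\<close>

definition falling :: "nat \<Rightarrow> nat \<Rightarrow> real" where
  "falling k l = (\<Prod>i<l. real k - real i)"

definition max_obs :: "nat \<Rightarrow> (nat \<Rightarrow> 'a \<Rightarrow> nat) \<Rightarrow> 'a \<Rightarrow> nat" where
  "max_obs n X \<omega> = Max ((\<lambda>i. X i \<omega>) ` {1..n})"

definition num_max :: "nat \<Rightarrow> (nat \<Rightarrow> 'a \<Rightarrow> nat) \<Rightarrow> 'a \<Rightarrow> nat" where
  "num_max n X \<omega> = card {i \<in> {1..n}. X i \<omega> = max_obs n X \<omega>}"

text \<open>The two random variables may live on different probability spaces, since the total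
  variation distance depends only on their laws.  The supremum ranges over all sets of
  natural numbers and is bounded by \<open>1\<close> for probability spaces.\<close>

definition dTV :: "'a measure \<Rightarrow> ('a \<Rightarrow> nat) \<Rightarrow> 'b measure \<Rightarrow> ('b \<Rightarrow> nat) \<Rightarrow> real" where
  "dTV M K N L =
     (SUP E\<in>(UNIV :: nat set set).
        \<bar>measure M {\<omega> \<in> space M. K \<omega> \<in> E} - measure N {\<omega> \<in> space N. L \<omega> \<in> E}\<bar>)"

end

theory Submission
  imports Defs
begin

text \<open>
  Write \<open>K\<close> for the number of maxima, \<open>\<mu> = E K\<close> and \<open>\<lambda> = E (K)\<^sub>2 / \<mu>\<close>, and let a star denote the
  size-biased law, with \<open>P (Z* = k) = k P (Z = k) / E Z\<close>. The bound comes from the chain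
  \<open>K\<close>, \<open>K*\<close>, \<open>Y + 1\<close>, \<open>Y\<close>.

  A nonnegative random variable \<open>Z\<close> of positive mean is within \<open>sd Z / (2 E Z)\<close> of its size-biased version, in total variation
  (\<open>size_bias_event_bound\<close>). For \<open>K\<close> this is the first summand, because
  \<open>Var K = E (K)\<^sub>2 - \<mu> (\<mu> - 1)\<close>. For \<open>Y\<close>, whose size-biased version is \<open>Y + 1\<close>, it is
  \<open>1 / (2 sqrt \<lambda>)\<close>, the second summand (\<open>poisson_shift_event_bound\<close>).

  For the step from \<open>K*\<close> to \<open>Y + 1\<close>, let \<open>p\<close> and \<open>F\<close> be the mass function and the distribution
  function of the sample. From \<open>P (K = k) = (n choose k) \<Sum>\<^sub>j p(j)^k F(j - 1)^(n - k)\<close> one sees that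
  \<open>K* - 1\<close> is a mixture of binomial laws with \<open>n - 1\<close> trials and success probability
  \<open>q(j) = p(j) / F(j)\<close>, where \<open>j\<close> has weights proportional to \<open>p(j) F(j)^(n - 1)\<close>
  (\<open>num_max_size_bias\<close>). Hence \<open>\<lambda> = (n - 1) E q\<close> and \<open>E (K)\<^sub>3 = \<mu> (n - 1) (n - 2) E q\<^sup>2\<close>. Stein's method, with
  the bound \<open>1 / \<lambda>\<close> on the increments of the Stein solution (\<open>poisson_stein_lipschitz\<close>), gives the
  distance \<open>E q + (n - 2) Var q / E q\<close> from the Poisson law (\<open>mixed_binomial_poisson_bound\<close>). The
  remaining two summands amount to \<open>E q + (n - 1) Var q / E q\<close>, which is at least as large.
\<close>

section \<open>Distance from the size-biased law\<close>

text \<open>For \<open>Z \<ge> 0\<close> the quotient \<open>E (Z 1\<^sub>A) / E Z\<close> is the size-biased probability of \<open>A\<close>, so this bounds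
  the total variation distance between a law and its size-biased version. The sign of \<open>Z\<close> is not
  needed.\<close>

lemma (in prob_space) size_bias_event_bound:
  fixes Z :: "'a \<Rightarrow> real"
  assumes Z [measurable]: "Z \<in> borel_measurable M" and sq: "integrable M (\<lambda>\<omega>. (Z \<omega>)\<^sup>2)"
    and pos: "expectation Z > 0" and A [measurable]: "A \<in> events"
  shows "\<bar>prob A - expectation (\<lambda>\<omega>. Z \<omega> * indicator A \<omega>) / expectation Z\<bar>
           \<le> sqrt (variance Z) / (2 * expectation Z)"
proof -
  define \<mu> where "\<mu> = expectation Z"
  have \<mu>: "\<mu> > 0" using pos by (simp add: \<mu>_def)
  have intZ: "integrable M Z"
    using square_integrable_imp_integrable[OF Z sq] .
  have intA: "integrable M (\<lambda>\<omega>. Z \<omega> * indicator A \<omega>)"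
    using integrable_real_mult_indicator[OF A intZ] by (simp add: mult.commute)
  have indA: "integrable M (indicat_real A)" by (simp add: emeasure_eq_measure)
  have int2: "integrable M (\<lambda>\<omega>. \<bar>Z \<omega> - \<mu>\<bar>\<^sup>2)"
    using sq intZ by (simp add: power2_diff)
  have int1: "integrable M (\<lambda>\<omega>. \<bar>Z \<omega> - \<mu>\<bar>)"
    using intZ by simp
  have "(expectation (\<lambda>\<omega>. \<bar>Z \<omega> - \<mu>\<bar>))\<^sup>2 \<le> expectation (\<lambda>\<omega>. \<bar>Z \<omega> - \<mu>\<bar>\<^sup>2)"
    using variance_positive[of "\<lambda>\<omega>. \<bar>Z \<omega> - \<mu>\<bar>"] variance_eq[OF int1 int2] by simp
  then have L1: "expectation (\<lambda>\<omega>. \<bar>Z \<omega> - \<mu>\<bar>) \<le> sqrt (variance Z)"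
    by (intro real_le_rsqrt) (simp add: \<mu>_def)
  \<comment> \<open>Since \<open>\<mu> - Z\<close> has mean zero, the indicator may be centred at \<open>1 / 2\<close>, which saves a factor
    of two.\<close>
  have "expectation (\<lambda>\<omega>. (\<mu> - Z \<omega>) * (indicator A \<omega> - 1 / 2))
      = expectation (\<lambda>\<omega>. \<mu> * indicator A \<omega> - Z \<omega> * indicator A \<omega> - \<mu> / 2 + Z \<omega> / 2)"
    by (intro Bochner_Integration.integral_cong) (auto simp: field_simps split: split_indicator)
  also have "\<dots> = \<mu> * prob A - expectation (\<lambda>\<omega>. Z \<omega> * indicator A \<omega>) - \<mu> / 2 + \<mu> / 2"
    using intA intZ indA by (simp add: prob_space flip: \<mu>_def)
  finally have eq: "\<mu> * prob A - expectation (\<lambda>\<omega>. Z \<omega> * indicator A \<omega>)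
      = expectation (\<lambda>\<omega>. (\<mu> - Z \<omega>) * (indicator A \<omega> - 1 / 2))" by simp
  also have "\<bar>\<dots>\<bar> \<le> expectation (\<lambda>\<omega>. \<bar>(\<mu> - Z \<omega>) * (indicator A \<omega> - 1 / 2)\<bar>)"
    by (rule integral_abs_bound)
  also have "\<dots> = expectation (\<lambda>\<omega>. \<bar>Z \<omega> - \<mu>\<bar> / 2)"
    by (intro Bochner_Integration.integral_cong) (auto simp: abs_mult split: split_indicator)
  also have "\<dots> = expectation (\<lambda>\<omega>. \<bar>Z \<omega> - \<mu>\<bar>) / 2" by simp
  also have "\<dots> \<le> sqrt (variance Z) / 2" using L1 by simp
  finally have "\<bar>\<mu> * prob A - expectation (\<lambda>\<omega>. Z \<omega> * indicator A \<omega>)\<bar> \<le> sqrt (variance Z) / 2" .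
  then have "\<bar>\<mu> * prob A - expectation (\<lambda>\<omega>. Z \<omega> * indicator A \<omega>)\<bar> / \<mu> \<le> sqrt (variance Z) / 2 / \<mu>"
    using \<mu> by (intro divide_right_mono) auto
  also have "\<bar>\<mu> * prob A - expectation (\<lambda>\<omega>. Z \<omega> * indicator A \<omega>)\<bar> / \<mu>
      = \<bar>(\<mu> * prob A - expectation (\<lambda>\<omega>. Z \<omega> * indicator A \<omega>)) / \<mu>\<bar>"
    using \<mu> by simp
  also have "(\<mu> * prob A - expectation (\<lambda>\<omega>. Z \<omega> * indicator A \<omega>)) / \<mu>
      = prob A - expectation (\<lambda>\<omega>. Z \<omega> * indicator A \<omega>) / \<mu>"
    using \<mu> by (simp add: field_simps)
  finally show ?thesis by (simp add: \<mu>_def)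
qed

section \<open>Size biasing and moments of the Poisson law\<close>

lemma integrable_pmf_nat_iff:
  fixes p :: "nat pmf" and f :: "nat \<Rightarrow> real"
  shows "integrable (measure_pmf p) f \<longleftrightarrow> summable (\<lambda>k. pmf p k * \<bar>f k\<bar>)"
  by (simp add: measure_pmf_eq_density[of p] integrable_density integrable_count_space_nat_iff abs_mult)

lemma pmf_nat_sums_expectation:
  fixes p :: "nat pmf" and f :: "nat \<Rightarrow> real"
  assumes "integrable (measure_pmf p) f"
  shows "(\<lambda>k. pmf p k * f k) sums measure_pmf.expectation p f"
  using sums_integral_count_space_nat[of "\<lambda>k. pmf p k * f k"] assms
  by (simp add: measure_pmf_eq_density[of p] integrable_density integral_density)

lemma poisson_pmf_Suc:
  assumes "l > 0"
  shows "pmf (poisson_pmf l) (Suc k) * real (Suc k) = l * pmf (poisson_pmf l) k"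
  using assms by (simp add: field_simps del: of_nat_Suc)

lemma poisson_pmf_pos: "l > 0 \<Longrightarrow> pmf (poisson_pmf l) k > 0"
  by simp

text \<open>The size-biased Poisson law is the Poisson law shifted by one.\<close>

lemma poisson_size_bias:
  fixes f :: "nat \<Rightarrow> real"
  assumes l: "l > 0" and int: "integrable (poisson_pmf l) (\<lambda>k. f (Suc k))"
  shows "integrable (poisson_pmf l) (\<lambda>k. real k * f k)"
    and "measure_pmf.expectation (poisson_pmf l) (\<lambda>k. real k * f k)
           = l * measure_pmf.expectation (poisson_pmf l) (\<lambda>k. f (Suc k))"
proof -
  let ?p = "pmf (poisson_pmf l)"
  have shift: "?p (Suc k) * (real (Suc k) * x) = l * (?p k * x)" for k x
    using poisson_pmf_Suc[OF l, of k] by (metis mult.assoc)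
  have "summable (\<lambda>k. l * (?p k * \<bar>f (Suc k)\<bar>))"
    using int by (intro summable_mult) (simp add: integrable_pmf_nat_iff)
  then have "summable (\<lambda>k. ?p (Suc k) * (real (Suc k) * \<bar>f (Suc k)\<bar>))"
    by (simp only: shift)
  then have "summable (\<lambda>k. ?p k * (real k * \<bar>f k\<bar>))"
    by (subst (asm) summable_Suc_iff)
  then show int': "integrable (poisson_pmf l) (\<lambda>k. real k * f k)"
    by (simp add: integrable_pmf_nat_iff abs_mult)
  have "(\<lambda>k. ?p (Suc k) * (real (Suc k) * f (Suc k))) sums
          (l * measure_pmf.expectation (poisson_pmf l) (\<lambda>k. f (Suc k)))"
    unfolding shift by (intro sums_mult pmf_nat_sums_expectation int)
  then have "(\<lambda>k. ?p k * (real k * f k)) sums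
          (l * measure_pmf.expectation (poisson_pmf l) (\<lambda>k. f (Suc k)))"
    by (subst (asm) sums_Suc_iff) simp
  with pmf_nat_sums_expectation[OF int']
  show "measure_pmf.expectation (poisson_pmf l) (\<lambda>k. real k * f k)
           = l * measure_pmf.expectation (poisson_pmf l) (\<lambda>k. f (Suc k))"
    by (rule sums_unique2)
qed

lemma poisson_moments:
  assumes l: "l > 0"
  shows "integrable (poisson_pmf l) (\<lambda>k. (real k)\<^sup>2)"
    and "measure_pmf.expectation (poisson_pmf l) real = l"
    and "measure_pmf.variance (poisson_pmf l) real = l"
proof -
  note 1 = poisson_size_bias[OF l, of "\<lambda>_. 1", simplified]
  have "integrable (poisson_pmf l) (\<lambda>k. real k + 1)" using 1(1) by simp
  then have i: "integrable (poisson_pmf l) (\<lambda>k. real (Suc k))" by (simp add: algebra_simps)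
  note 2 = poisson_size_bias[OF l, of real, OF i]
  show sq: "integrable (poisson_pmf l) (\<lambda>k. (real k)\<^sup>2)"
    using 2(1) by (simp add: power2_eq_square)
  show m: "measure_pmf.expectation (poisson_pmf l) real = l" using 1(2) by simp
  have "measure_pmf.expectation (poisson_pmf l) (\<lambda>k. (real k)\<^sup>2) = l * (1 + l)"
    using 2(2) 1 by (simp add: power2_eq_square)
  then show "measure_pmf.variance (poisson_pmf l) real = l"
    using measure_pmf.variance_eq[OF 1(1) sq] m by (simp add: algebra_simps power2_eq_square)
qed

lemma poisson_prob_shift:
  assumes l: "l > 0"
  shows "integrable (poisson_pmf l) (\<lambda>k. real k * indicator E k)"
    and "measure_pmf.expectation (poisson_pmf l) (\<lambda>k. real k * indicator E k)
           = l * measure_pmf.prob (poisson_pmf l) (Suc -` E)"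
proof -
  have eq: "(\<lambda>k. indicator E (Suc k) :: real) = indicator (Suc -` E)"
    by (auto simp: fun_eq_iff split: split_indicator)
  note * = poisson_size_bias[OF l, of "indicator E", unfolded eq]
  show "integrable (poisson_pmf l) (\<lambda>k. real k * indicator E k)"
    by (rule *) (simp add: measure_pmf.emeasure_eq_measure)
  show "measure_pmf.expectation (poisson_pmf l) (\<lambda>k. real k * indicator E k)
           = l * measure_pmf.prob (poisson_pmf l) (Suc -` E)"
    by (subst *) (simp_all add: measure_pmf.emeasure_eq_measure)
qed

text \<open>The bound for size biasing, applied to the Poisson law: both its mean and its variance are \<open>l\<close>.\<close>

lemma poisson_shift_event_bound:
  assumes l: "l > 0"
  shows "\<bar>measure_pmf.prob (poisson_pmf l) E - measure_pmf.prob (poisson_pmf l) (Suc -` E)\<bar>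
           \<le> 1 / (2 * sqrt l)"
proof -
  have "sqrt l / (2 * l) = 1 / (2 * sqrt l)"
    using l by (simp add: field_simps)
  then show ?thesis
    using measure_pmf.size_bias_event_bound[of real "poisson_pmf l" E] poisson_moments[OF l] l
      poisson_prob_shift(2)[OF l, of E]
    by simp
qed

section \<open>The Stein equation of the Poisson law\<close>

text \<open>The solution of the Stein equation for the Poisson law with mean \<open>l\<close> and the event \<open>A\<close>, in closed
  form. The index is shifted by one: \<open>poisson_stein l A k\<close> is the value at \<open>k + 1\<close> of the usual solution,
  whose value at \<open>0\<close> is immaterial.\<close>

definition poisson_stein :: "real \<Rightarrow> nat set \<Rightarrow> nat \<Rightarrow> real" where
  "poisson_stein l A k =
     (measure_pmf.prob (poisson_pmf l) (A \<inter> {..k})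
       - measure_pmf.prob (poisson_pmf l) A * measure_pmf.prob (poisson_pmf l) {..k})
     / (l * pmf (poisson_pmf l) k)"

text \<open>For \<open>k = 0\<close> the truncated \<open>k - 1\<close> is harmless, because its term has the factor \<open>k\<close>.\<close>

lemma poisson_stein_equation:
  assumes l: "l > 0"
  shows "l * poisson_stein l A k - real k * poisson_stein l A (k - 1)
           = indicator A k - measure_pmf.prob (poisson_pmf l) A"
proof -
  let ?P = "measure_pmf.prob (poisson_pmf l)" and ?p = "pmf (poisson_pmf l)"
  define D where "D k = ?P (A \<inter> {..k}) - ?P A * ?P {..k}" for k
  have pos: "?p k > 0" for k using l by (rule poisson_pmf_pos)
  have S: "l * poisson_stein l A k = D k / ?p k" for k
    using l by (simp add: poisson_stein_def D_def)
  have ind: "?P (A \<inter> {k}) = ?p k * indicator A k" for k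
    by (auto simp: measure_pmf_single split: split_indicator)
  show ?thesis
  proof (cases k)
    case 0
    have "{..0::nat} = {0}" by auto
    then have "D 0 = ?p 0 * (indicator A 0 - ?P A)"
      using ind[of 0] by (simp add: D_def measure_pmf_single algebra_simps)
    then show ?thesis using S[of 0] pos[of 0] 0 by (simp del: pmf_poisson)
  next
    case (Suc j)
    have "{..Suc j} = {..j} \<union> {Suc j}" by auto
    then have 1: "?P {..Suc j} = ?P {..j} + ?p (Suc j)"
      using measure_pmf.finite_measure_Union[of "{..j}" "poisson_pmf l" "{Suc j}"]
      by (simp add: measure_pmf_single del: atMost_Suc)
    have "A \<inter> {..Suc j} = A \<inter> {..j} \<union> A \<inter> {Suc j}" by auto
    then have "?P (A \<inter> {..Suc j}) = ?P (A \<inter> {..j}) + ?P (A \<inter> {Suc j})"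
      by (simp only:) (rule measure_pmf.finite_measure_Union, auto)
    with 1 ind[of "Suc j"] have D: "D (Suc j) = D j + ?p (Suc j) * (indicator A (Suc j) - ?P A)"
      by (simp add: D_def algebra_simps del: atMost_Suc pmf_poisson)
    have "real (Suc j) * poisson_stein l A j = real (Suc j) * D j / (l * ?p j)"
      using l by (simp add: poisson_stein_def D_def)
    also have "\<dots> = D j / ?p (Suc j)"
      unfolding poisson_pmf_Suc[OF l, symmetric]
      using pos[of "Suc j"] by (simp del: pmf_poisson of_nat_Suc)
    finally have "real (Suc j) * poisson_stein l A j = D j / ?p (Suc j)" .
    moreover have "D (Suc j) / ?p (Suc j) = D j / ?p (Suc j) + (indicator A (Suc j) - ?P A)"
      using D pos[of "Suc j"] by (simp add: add_divide_distrib del: pmf_poisson)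
    ultimately show ?thesis
      using S[of "Suc j"] Suc by (simp del: pmf_poisson of_nat_Suc)
  qed
qed

text \<open>In terms of the mass function \<open>\<pi>\<close>, where \<open>(k + 1) \<pi>(k + 1) = l \<pi>(k)\<close>, this and the next lemma say that
  \<open>P {..k} / \<pi>(k)\<close> is increasing and \<open>P {k<..} / \<pi>(k)\<close> is decreasing in \<open>k\<close>. Both follow from
  \<open>E (Y 1\<^sub>E) = l P (Y + 1 \<in> E)\<close>.\<close>

lemma poisson_cdf_step:
  assumes l: "l > 0"
  shows "l * measure_pmf.prob (poisson_pmf l) {..k}
           \<le> real (Suc k) * measure_pmf.prob (poisson_pmf l) {..Suc k}"
proof -
  have "Suc -` {..Suc k} = {..k}" by auto
  then have "l * measure_pmf.prob (poisson_pmf l) {..k}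
      = measure_pmf.expectation (poisson_pmf l) (\<lambda>j. real j * indicator {..Suc k} j)"
    using poisson_prob_shift(2)[OF l, of "{..Suc k}"] by simp
  also have "\<dots> \<le> measure_pmf.expectation (poisson_pmf l) (\<lambda>j. real (Suc k) * indicator {..Suc k} j)"
    by (intro integral_mono poisson_prob_shift l)
       (auto simp: measure_pmf.emeasure_eq_measure split: split_indicator)
  also have "\<dots> = real (Suc k) * measure_pmf.prob (poisson_pmf l) {..Suc k}" by simp
  finally show ?thesis .
qed

lemma poisson_tail_step:
  assumes l: "l > 0"
  shows "real (Suc k) * measure_pmf.prob (poisson_pmf l) {Suc k<..}
           \<le> l * measure_pmf.prob (poisson_pmf l) {k<..}"
proof -
  have "real (Suc k) * measure_pmf.prob (poisson_pmf l) {Suc k<..}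
      = measure_pmf.expectation (poisson_pmf l) (\<lambda>j. real (Suc k) * indicator {Suc k<..} j)" by simp
  also have "\<dots> \<le> measure_pmf.expectation (poisson_pmf l) (\<lambda>j. real j * indicator {Suc k<..} j)"
    by (intro integral_mono poisson_prob_shift l)
       (auto simp: measure_pmf.emeasure_eq_measure split: split_indicator)
  also have "\<dots> = l * measure_pmf.prob (poisson_pmf l) (Suc -` {Suc k<..})"
    using poisson_prob_shift(2)[OF l] by simp
  also have "Suc -` {Suc k<..} = {k<..}" by auto
  finally show ?thesis .
qed

lemma poisson_stein_compl:
  assumes l: "l > 0"
  shows "poisson_stein l (- A) k = - poisson_stein l A k"
proof -
  let ?P = "measure_pmf.prob (poisson_pmf l)"
  have 1: "?P (- A) = 1 - ?P A"
    using measure_pmf.prob_compl[of A "poisson_pmf l"] by (simp add: Compl_eq_Diff_UNIV)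
  have "{..k} = (A \<inter> {..k}) \<union> (- A \<inter> {..k})" by auto
  then have "?P {..k} = ?P ((A \<inter> {..k}) \<union> (- A \<inter> {..k}))" by simp
  also have "\<dots> = ?P (A \<inter> {..k}) + ?P (- A \<inter> {..k})"
    by (rule measure_pmf.finite_measure_Union) auto
  finally have 2: "?P (- A \<inter> {..k}) = ?P {..k} - ?P (A \<inter> {..k})" by simp
  show ?thesis
    unfolding poisson_stein_def 1 2 by (simp add: minus_divide_left algebra_simps del: pmf_poisson)
qed

text \<open>Split \<open>A\<close> at \<open>k\<close>: \<open>l\<close> times the solution is \<open>P (A \<inter> {..k}) U(k) - P (A \<inter> {k<..}) G(k)\<close>, where
  \<open>U(k) = P {k<..} / \<pi>(k)\<close> decreases and \<open>G(k) = P {..k} / \<pi>(k)\<close> increases. Passing from \<open>k\<close> to \<open>k + 1\<close>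
  can therefore raise it only through the point \<open>k + 1\<close>, when that point lies in \<open>A\<close>.\<close>

lemma poisson_stein_increment_le:
  assumes l: "l > 0"
  shows "poisson_stein l A (Suc k) - poisson_stein l A k \<le> 1 / l"
proof -
  let ?P = "measure_pmf.prob (poisson_pmf l)" and ?p = "pmf (poisson_pmf l)"
  define U where "U k = ?P {k<..} / ?p k" for k
  define G where "G k = ?P {..k} / ?p k" for k
  define a where "a k = ?P (A \<inter> {..k})" for k
  define b where "b k = ?P (A \<inter> {k<..})" for k
  define d where "d = ?P (A \<inter> {Suc k})"
  have pos: "?p k > 0" for k using l by (rule poisson_pmf_pos)
  have Suc: "?p (Suc k) = l * ?p k / real (Suc k)"
    using poisson_pmf_Suc[OF l, of k] by (simp add: field_simps del: pmf_poisson)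
  have total: "?P {..k} + ?P {k<..} = 1" for k
  proof -
    have "{..k} \<union> {k<..} = UNIV" "{..k} \<inter> {k<..} = {}" by auto
    then show ?thesis
      using measure_pmf.finite_measure_Union[of "{..k}" "poisson_pmf l" "{k<..}"] by simp
  qed
  have ab: "?P A = a k + b k" for k
  proof -
    have "A = (A \<inter> {..k}) \<union> (A \<inter> {k<..})" by auto
    then have "?P A = ?P ((A \<inter> {..k}) \<union> (A \<inter> {k<..}))" by simp
    also have "\<dots> = a k + b k"
      unfolding a_def b_def by (rule measure_pmf.finite_measure_Union) auto
    finally show ?thesis .
  qed
  have S: "l * poisson_stein l A k = a k * U k - b k * G k" for k
  proof -
    have "l * poisson_stein l A k = (a k - (a k + b k) * ?P {..k}) / ?p k"
      using l ab[of k] by (simp add: poisson_stein_def a_def)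
    also have "a k - (a k + b k) * ?P {..k} = a k * ?P {k<..} - b k * ?P {..k}"
    proof -
      have "?P {k<..} = 1 - ?P {..k}" using total[of k] by simp
      then show ?thesis by (simp only:) (simp add: algebra_simps)
    qed
    finally show ?thesis by (simp add: U_def G_def diff_divide_distrib)
  qed
  have "A \<inter> {..Suc k} = A \<inter> {..k} \<union> A \<inter> {Suc k}" by auto
  then have a: "a (Suc k) = a k + d"
    unfolding a_def d_def by (simp only:) (rule measure_pmf.finite_measure_Union, auto)
  with ab[of k] ab[of "Suc k"] have b: "b k = b (Suc k) + d" by simp
  have d: "0 \<le> d" "d \<le> ?p (Suc k)"
    using measure_pmf.finite_measure_mono[of "A \<inter> {Suc k}" "{Suc k}" "poisson_pmf l"]
    by (auto simp: d_def measure_pmf_single)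
  have U: "U (Suc k) \<le> U k"
    using poisson_tail_step[OF l, of k] pos[of k] l
    by (simp add: U_def Suc field_simps del: pmf_poisson of_nat_Suc)
  have G: "G k \<le> G (Suc k)"
    using poisson_cdf_step[OF l, of k] pos[of k] l
    by (simp add: G_def Suc field_simps del: pmf_poisson of_nat_Suc atMost_Suc)
  have nonneg: "0 \<le> U k" "0 \<le> G k" "0 \<le> a k" "0 \<le> b k" for k
    using pos[of k] by (auto simp: U_def G_def a_def b_def simp del: pmf_poisson)
  have "l * (poisson_stein l A (Suc k) - poisson_stein l A k)
      = a k * (U (Suc k) - U k) + b (Suc k) * (G k - G (Suc k)) + d * (U (Suc k) + G k)"
    unfolding right_diff_distrib[of l] S a b by (simp add: algebra_simps)
  also have "\<dots> \<le> d * (U (Suc k) + G k)"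
    using mult_nonneg_nonpos[OF nonneg(3)[of k], of "U (Suc k) - U k"] U
      mult_nonneg_nonpos[OF nonneg(4)[of "Suc k"], of "G k - G (Suc k)"] G by simp
  also have "\<dots> \<le> ?p (Suc k) * (U (Suc k) + G k)"
    using d nonneg by (intro mult_right_mono add_nonneg_nonneg) auto
  also have "\<dots> = ?P {Suc k<..} + l * ?P {..k} / real (Suc k)"
    using pos[of k] pos[of "Suc k"] Suc l
    by (simp add: U_def G_def distrib_left del: pmf_poisson of_nat_Suc)
  also have "\<dots> \<le> ?P {Suc k<..} + ?P {..Suc k}"
    using poisson_cdf_step[OF l, of k] by (simp add: field_simps del: of_nat_Suc atMost_Suc)
  also have "\<dots> = 1" using total[of "Suc k"] by simp
  finally show ?thesis using l by (simp add: field_simps)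
qed

text \<open>The lower bound is the upper bound for the complement of \<open>A\<close>. The factor \<open>1 / l\<close> is what makes
  the final estimate of the right order.\<close>

lemma poisson_stein_lipschitz:
  assumes l: "l > 0"
  shows "\<bar>poisson_stein l A (Suc k) - poisson_stein l A k\<bar> \<le> 1 / l"
  using poisson_stein_increment_le[OF l, of A k] poisson_stein_increment_le[OF l, of "- A" k]
  by (simp add: poisson_stein_compl[OF l])

section \<open>Binomial means as functions of the success probability\<close>

text \<open>The mean of \<open>f\<close> under the binomial law with \<open>m\<close> trials and success probability \<open>q\<close>. It is
  meaningful for \<open>q\<close> in the unit interval only.\<close>

definition binomial_mean :: "nat \<Rightarrow> real \<Rightarrow> (nat \<Rightarrow> real) \<Rightarrow> real" where
  "binomial_mean m q f = measure_pmf.expectation (binomial_pmf m q) f"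

lemma binomial_mean_sum:
  assumes "q \<in> {0..1}"
  shows "binomial_mean m q f = (\<Sum>k\<le>m. real (m choose k) * q ^ k * (1 - q) ^ (m - k) * f k)"
  using expectation_binomial_pmf'[OF assms, of m f] by (simp add: binomial_mean_def)

lemma binomial_mean_0 [simp]: "q \<in> {0..1} \<Longrightarrow> binomial_mean 0 q f = f 0"
  by (simp add: binomial_mean_sum)

text \<open>Conditioning on the first trial.\<close>

lemma binomial_mean_Suc:
  assumes q: "q \<in> {0..1}"
  shows "binomial_mean (Suc m) q f
           = q * binomial_mean m q (\<lambda>k. f (Suc k)) + (1 - q) * binomial_mean m q f"
proof -
  have "binomial_mean (Suc m) q f = (\<Sum>b\<in>UNIV. pmf (bernoulli_pmf q) b *
          measure_pmf.expectation (binomial_pmf m q \<bind> (\<lambda>k. return_pmf ((if b then 1 else 0) + k))) f)"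
    unfolding binomial_mean_def binomial_pmf_Suc[OF q]
    using q by (subst pmf_expectation_bind[of UNIV]) (auto intro!: finite_UN_I)
  also have "\<dots> = q * binomial_mean m q (\<lambda>k. f (Suc k)) + (1 - q) * binomial_mean m q f"
    using q by (simp add: UNIV_bool binomial_mean_def map_pmf_def[symmetric] add.commute)
  finally show ?thesis .
qed

lemma binomial_mean_linear:
  assumes "q \<in> {0..1}"
  shows "binomial_mean m q (\<lambda>k. f k + g k) = binomial_mean m q f + binomial_mean m q g"
    and "binomial_mean m q (\<lambda>k. f k - g k) = binomial_mean m q f - binomial_mean m q g"
    and "binomial_mean m q (\<lambda>k. c * f k) = c * binomial_mean m q f"
    and "binomial_mean m q (\<lambda>_. c) = c"
  using assms by (simp_all add: binomial_mean_def)

lemma abs_binomial_mean_le: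
  assumes q: "q \<in> {0..1}" and "\<And>k. k \<le> m \<Longrightarrow> \<bar>f k\<bar> \<le> B"
  shows "\<bar>binomial_mean m q f\<bar> \<le> B"
  using assms(2)
proof (induction m arbitrary: f)
  case 0
  then show ?case using q by simp
next
  case (Suc m)
  have "\<bar>binomial_mean (Suc m) q f\<bar>
      \<le> q * \<bar>binomial_mean m q (\<lambda>k. f (Suc k))\<bar> + (1 - q) * \<bar>binomial_mean m q f\<bar>"
    unfolding binomial_mean_Suc[OF q] using q by (intro abs_triangle_ineq[THEN order_trans]) (simp add: abs_mult)
  also have "\<dots> \<le> q * B + (1 - q) * B"
    using q Suc by (intro add_mono mult_left_mono) auto
  finally show ?case by (simp add: algebra_simps)
qed

lemma integrable_pmf_unit_interval:
  fixes p :: "'c pmf" and q :: "'c \<Rightarrow> real"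
  assumes "\<And>j. q j \<in> {0..1}"
  shows "integrable p q"
proof (rule measure_pmf.integrable_const_bound)
  show "AE j in p. norm (q j) \<le> 1"
    using assms by (intro AE_pmfI) simp
qed simp

lemma integrable_binomial_mean:
  fixes p :: "'c pmf" and q :: "'c \<Rightarrow> real"
  assumes q: "\<And>j. q j \<in> {0..1}"
  shows "integrable p (\<lambda>j. binomial_mean m (q j) f)"
proof (rule measure_pmf.integrable_const_bound)
  show "AE j in p. norm (binomial_mean m (q j) f) \<le> (\<Sum>i\<le>m. \<bar>f i\<bar>)"
    by (intro AE_pmfI) (auto intro!: abs_binomial_mean_le q member_le_sum)
qed simp

lemma binomial_mean_size_bias:
  assumes q: "q \<in> {0..1}"
  shows "binomial_mean (Suc m) q (\<lambda>k. real k * f k)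
           = real (Suc m) * q * binomial_mean m q (\<lambda>k. f (Suc k))"
proof (induction m arbitrary: f)
  case 0
  show ?case using q by (simp add: binomial_mean_Suc)
next
  case (Suc m)
  have "binomial_mean (Suc (Suc m)) q (\<lambda>k. real k * f k)
      = q * binomial_mean (Suc m) q (\<lambda>k. f (Suc k) + real k * f (Suc k))
        + (1 - q) * binomial_mean (Suc m) q (\<lambda>k. real k * f k)"
    by (subst binomial_mean_Suc[OF q]) (simp add: algebra_simps)
  also have "\<dots> = q * binomial_mean (Suc m) q (\<lambda>k. f (Suc k))
        + real (Suc m) * q * (q * binomial_mean m q (\<lambda>k. f (Suc (Suc k)))
            + (1 - q) * binomial_mean m q (\<lambda>k. f (Suc k)))"
    by (simp add: binomial_mean_linear[OF q] Suc.IH Suc.IH[of "\<lambda>k. f (Suc k)"] algebra_simps)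
  also have "\<dots> = real (Suc (Suc m)) * q * binomial_mean (Suc m) q (\<lambda>k. f (Suc k))"
    by (simp add: binomial_mean_Suc[OF q, of m "\<lambda>k. f (Suc k)"] algebra_simps)
  finally show ?case .
qed

lemma binomial_mean_factorial_moments:
  assumes q: "q \<in> {0..1}"
  shows "binomial_mean m q real = real m * q"
    and "binomial_mean m q (\<lambda>k. real k * (real k - 1)) = real m * (real m - 1) * q\<^sup>2"
proof -
  show mean: "binomial_mean m q real = real m * q" for m
  proof (cases m)
    case (Suc j)
    then show ?thesis
      using binomial_mean_size_bias[OF q, of j "\<lambda>_. 1"] by (simp add: binomial_mean_linear[OF q])
  qed (use q in simp)
  show "binomial_mean m q (\<lambda>k. real k * (real k - 1)) = real m * (real m - 1) * q\<^sup>2"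
  proof (cases m)
    case (Suc j)
    then show ?thesis
      using binomial_mean_size_bias[OF q, of j "\<lambda>k. real k - 1"] mean[of j]
      by (simp add: power2_eq_square)
  qed (use q in simp)
qed

lemma binomial_mean_increment:
  assumes q: "q \<in> {0..1}" and f: "\<And>k. \<bar>f (Suc k) - f k\<bar> \<le> L"
  shows "\<bar>binomial_mean (Suc m) q f - binomial_mean m q f\<bar> \<le> L * q"
proof -
  have "binomial_mean (Suc m) q f - binomial_mean m q f = q * binomial_mean m q (\<lambda>k. f (Suc k) - f k)"
    by (simp add: binomial_mean_Suc[OF q] binomial_mean_linear[OF q] algebra_simps)
  also have "\<bar>\<dots>\<bar> = q * \<bar>binomial_mean m q (\<lambda>k. f (Suc k) - f k)\<bar>"
    using q by (simp add: abs_mult)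
  also have "\<dots> \<le> q * L"
    using q f by (intro mult_left_mono abs_binomial_mean_le) auto
  finally show ?thesis by (simp add: mult.commute)
qed

text \<open>By coupling, changing the success probability changes the number of successes by
  \<open>m \<bar>q - r\<bar>\<close> on average; the recursion on the number of trials replaces the coupling.\<close>

lemma binomial_mean_lipschitz:
  assumes q: "q \<in> {0..1}" and r: "r \<in> {0..1}" and f: "\<And>k. \<bar>f (Suc k) - f k\<bar> \<le> L"
  shows "\<bar>binomial_mean m q f - binomial_mean m r f\<bar> \<le> real m * L * \<bar>q - r\<bar>"
  using f
proof (induction m arbitrary: f)
  case 0
  then show ?case using q r by simp
next
  case (Suc m)
  let ?g = "\<lambda>k. f (Suc k)" and ?b = "\<lambda>q. binomial_mean m q"
  have "binomial_mean (Suc m) q f - binomial_mean (Suc m) r f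
      = q * (?b q ?g - ?b r ?g) + (1 - q) * (?b q f - ?b r f) + (q - r) * ?b r (\<lambda>k. ?g k - f k)"
    by (simp add: binomial_mean_Suc[OF q] binomial_mean_Suc[OF r] binomial_mean_linear[OF r] algebra_simps)
  also have "\<bar>\<dots>\<bar> \<le> q * \<bar>?b q ?g - ?b r ?g\<bar> + (1 - q) * \<bar>?b q f - ?b r f\<bar>
      + \<bar>q - r\<bar> * \<bar>?b r (\<lambda>k. ?g k - f k)\<bar>"
    using q by (intro order_trans[OF abs_triangle_ineq] add_mono) (auto simp: abs_mult)
  also have "\<dots> \<le> q * (real m * L * \<bar>q - r\<bar>) + (1 - q) * (real m * L * \<bar>q - r\<bar>) + \<bar>q - r\<bar> * L"
    using q r Suc by (intro add_mono mult_left_mono abs_binomial_mean_le) auto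
  also have "\<dots> = real (Suc m) * L * \<bar>q - r\<bar>" by (simp add: algebra_simps)
  finally show ?case .
qed

section \<open>Poisson approximation of mixed binomial laws\<close>

text \<open>Poisson approximation of a binomial law with random success probability \<open>q\<close>, mean \<open>\<theta>\<close>. By the
  Stein equation the difference is \<open>(m + 1) E (\<theta> G - q H)\<close>, where \<open>G\<close> and \<open>H\<close> are the conditional means
  of the Stein solution with \<open>m + 1\<close> and \<open>m\<close> trials. Write
  \<open>\<theta> G - q H = \<theta> (G - H) - (q - \<theta>) H\<close>. In the first term one trial is dropped. The second is a
  covariance of \<open>q\<close> with a Lipschitz function of \<open>q\<close>, hence bounded by a multiple of the variance
  of \<open>q\<close>.\<close>

lemma mixed_binomial_poisson_bound:
  fixes p :: "'c pmf" and q :: "'c \<Rightarrow> real"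
  defines "\<theta> \<equiv> measure_pmf.expectation p q"
  assumes q: "\<And>j. q j \<in> {0..1}" and pos: "\<theta> > 0"
  shows "\<bar>measure_pmf.expectation p (\<lambda>j. binomial_mean (Suc m) (q j) (indicator A))
            - measure_pmf.prob (poisson_pmf (real (Suc m) * \<theta>)) A\<bar>
         \<le> \<theta> + real m * measure_pmf.variance p q / \<theta>"
proof -
  let ?E = "measure_pmf.expectation p"
  define l where "l = real (Suc m) * \<theta>"
  have l: "l > 0" using pos by (simp add: l_def)
  define g where "g = poisson_stein l A"
  have g: "\<bar>g (Suc k) - g k\<bar> \<le> 1 / l" for k
    unfolding g_def by (rule poisson_stein_lipschitz[OF l])
  define G where "G j = binomial_mean (Suc m) (q j) g" for j
  define H where "H j = binomial_mean m (q j) g" for j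
  define H0 where "H0 = binomial_mean m \<theta> g"
  have int_q: "integrable p q" by (rule integrable_pmf_unit_interval[OF q])
  have \<theta>: "\<theta> \<in> {0..1}"
    using q pos measure_pmf.integral_le_const[OF int_q, of 1] by (auto simp: \<theta>_def)
  note int_b = integrable_binomial_mean[where q = q, OF q]
  have int_qb: "integrable p (\<lambda>j. q j * binomial_mean k (q j) f)" for k f
  proof (rule measure_pmf.integrable_const_bound)
    show "AE j in p. norm (q j * binomial_mean k (q j) f) \<le> 1 * (\<Sum>i\<le>k. \<bar>f i\<bar>)"
      unfolding norm_mult
      using q by (intro AE_pmfI mult_mono) (auto intro!: abs_binomial_mean_le member_le_sum)
  qed simp
  have int_GH: "integrable p G" "integrable p H" "integrable p (\<lambda>j. q j * H j)"
    unfolding G_def H_def by (intro int_b int_qb)+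
  have int_q2: "integrable p (\<lambda>j. (q j)\<^sup>2)"
    using q by (intro integrable_pmf_unit_interval) (simp add: power_le_one)
  have var_int: "integrable p (\<lambda>j. (q j - \<theta>)\<^sup>2)"
    using int_q int_q2 by (simp add: power2_diff)
  have conditional: "binomial_mean (Suc m) (q j) (indicator A) - measure_pmf.prob (poisson_pmf l) A
      = l * G j - real (Suc m) * q j * H j" for j
  proof -
    have "binomial_mean (Suc m) (q j) (indicator A) - measure_pmf.prob (poisson_pmf l) A
        = binomial_mean (Suc m) (q j) (\<lambda>k. indicator A k - measure_pmf.prob (poisson_pmf l) A)"
      by (simp only: binomial_mean_linear[OF q])
    also have "\<dots> = binomial_mean (Suc m) (q j) (\<lambda>k. l * g k - real k * g (k - 1))"
      unfolding g_def by (simp only: poisson_stein_equation[OF l])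
    also have "\<dots> = l * G j - real (Suc m) * q j * H j"
      by (simp only: binomial_mean_linear[OF q] binomial_mean_size_bias[OF q] G_def H_def diff_Suc_1)
    finally show ?thesis .
  qed
  have "?E (\<lambda>j. binomial_mean (Suc m) (q j) (indicator A)) - measure_pmf.prob (poisson_pmf l) A
      = ?E (\<lambda>j. binomial_mean (Suc m) (q j) (indicator A) - measure_pmf.prob (poisson_pmf l) A)"
    by (subst Bochner_Integration.integral_diff) (simp_all add: int_b)
  also have "\<dots> = ?E (\<lambda>j. real (Suc m) * (\<theta> * (G j - H j) - (q j - \<theta>) * (H j - H0) - (q j - \<theta>) * H0))"
    unfolding conditional by (intro Bochner_Integration.integral_cong) (auto simp: l_def algebra_simps)
  \<comment> \<open>\<open>H0\<close> is constant and \<open>q - \<theta>\<close> has mean zero.\<close>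
  also have "\<dots> = ?E (\<lambda>j. real (Suc m) * (\<theta> * (G j - H j) - (q j - \<theta>) * (H j - H0)))"
  proof -
    have "integrable p (\<lambda>j. (q j - \<theta>) * (H j - H0))"
      using int_GH int_q by (simp add: algebra_simps)
    moreover have "?E (\<lambda>j. (q j - \<theta>) * H0) = 0"
      using int_q by (simp add: \<theta>_def)
    ultimately show ?thesis
      using int_GH int_q by simp
  qed
  finally have eq: "?E (\<lambda>j. binomial_mean (Suc m) (q j) (indicator A)) - measure_pmf.prob (poisson_pmf l) A
      = ?E (\<lambda>j. real (Suc m) * (\<theta> * (G j - H j) - (q j - \<theta>) * (H j - H0)))" .
  have "\<bar>\<dots>\<bar> \<le> ?E (\<lambda>j. real (Suc m) * (\<theta> * (1 / l * q j) + real m * (1 / l) * (q j - \<theta>)\<^sup>2))"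
  proof (rule order_trans[OF integral_abs_bound], rule integral_mono)
    show "integrable p (\<lambda>j. \<bar>real (Suc m) * (\<theta> * (G j - H j) - (q j - \<theta>) * (H j - H0))\<bar>)"
    proof -
      have "integrable p (\<lambda>j. (q j - \<theta>) * (H j - H0))"
        using int_GH int_q by (simp add: algebra_simps)
      then show ?thesis using int_GH by simp
    qed
    show "integrable p (\<lambda>j. real (Suc m) * (\<theta> * (1 / l * q j) + real m * (1 / l) * (q j - \<theta>)\<^sup>2))"
      using int_q var_int by simp
    fix j
    have 1: "\<bar>\<theta> * (G j - H j)\<bar> \<le> \<theta> * (1 / l * q j)"
      using binomial_mean_increment[OF q, where f = g, OF g] \<theta> unfolding G_def H_def abs_mult
      by (intro mult_mono) auto
    have "\<bar>(q j - \<theta>) * (H j - H0)\<bar> \<le> \<bar>q j - \<theta>\<bar> * (real m * (1 / l) * \<bar>q j - \<theta>\<bar>)"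
      using binomial_mean_lipschitz[OF q \<theta>, where f = g, OF g] unfolding H0_def H_def abs_mult
      by (intro mult_left_mono) auto
    also have "\<dots> = real m * (1 / l) * (q j - \<theta>)\<^sup>2"
    proof -
      have "\<bar>q j - \<theta>\<bar> * \<bar>q j - \<theta>\<bar> = (q j - \<theta>)\<^sup>2" by (simp add: power2_eq_square)
      from arg_cong[OF this, of "\<lambda>x. real m * (1 / l) * x"] show ?thesis
        by (simp only: ac_simps)
    qed
    finally have 2: "\<bar>(q j - \<theta>) * (H j - H0)\<bar> \<le> real m * (1 / l) * (q j - \<theta>)\<^sup>2" .
    show "\<bar>real (Suc m) * (\<theta> * (G j - H j) - (q j - \<theta>) * (H j - H0))\<bar>
        \<le> real (Suc m) * (\<theta> * (1 / l * q j) + real m * (1 / l) * (q j - \<theta>)\<^sup>2)"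
      unfolding abs_mult[of "real (Suc m)"] using 1 2 by (intro mult_mono) auto
  qed
  also have "\<dots> = real (Suc m) * (\<theta> * (1 / l * \<theta>) + real m * (1 / l) * measure_pmf.variance p q)"
    using int_q var_int by (simp add: \<theta>_def[symmetric] del: of_nat_Suc)
  also have "\<dots> = \<theta> + real m * measure_pmf.variance p q / \<theta>"
    using pos by (simp add: l_def field_simps del: of_nat_Suc)
  finally show ?thesis unfolding eq[symmetric] l_def .
qed

section \<open>The law of the number of maxima\<close>

text \<open>The event that exactly the sample positions in \<open>S\<close> attain the maximum, and that the maximum is \<open>j\<close>,
  is a product event.\<close>

lemma num_max_eq_cell:
  assumes S: "S \<subseteq> {1..n}" "S \<noteq> {}"
  shows "(\<forall>i\<in>{1..n}. X i \<omega> \<in> (if i \<in> S then {j} else {..<j})) \<longleftrightarrow>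
           max_obs n X \<omega> = j \<and> {i \<in> {1..n}. X i \<omega> = j} = S"
proof
  assume L: "\<forall>i\<in>{1..n}. X i \<omega> \<in> (if i \<in> S then {j} else {..<j})"
  have eq: "{i \<in> {1..n}. X i \<omega> = j} = S"
    using L S by (fastforce split: if_splits)
  obtain s where s: "s \<in> S" "s \<in> {1..n}" using S by blast
  have "max_obs n X \<omega> = j"
    unfolding max_obs_def
  proof (rule Max_eqI)
    show "j \<in> (\<lambda>i. X i \<omega>) ` {1..n}" using L s by force
    fix y assume "y \<in> (\<lambda>i. X i \<omega>) ` {1..n}"
    then show "y \<le> j" using L by (force split: if_splits)
  qed simp
  with eq show "max_obs n X \<omega> = j \<and> {i \<in> {1..n}. X i \<omega> = j} = S" by simp
next
  assume R: "max_obs n X \<omega> = j \<and> {i \<in> {1..n}. X i \<omega> = j} = S"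
  show "\<forall>i\<in>{1..n}. X i \<omega> \<in> (if i \<in> S then {j} else {..<j})"
  proof
    fix i assume i: "i \<in> {1..n}"
    then have "X i \<omega> \<le> j" using R by (auto simp: max_obs_def intro!: Max_ge)
    moreover have "X i \<omega> = j \<longleftrightarrow> i \<in> S" using R i by blast
    ultimately show "X i \<omega> \<in> (if i \<in> S then {j} else {..<j})" by auto
  qed
qed

lemma num_max_le: "num_max n X \<omega> \<le> n"
proof -
  have "card {i \<in> {1..n}. X i \<omega> = max_obs n X \<omega>} \<le> card {1..n}"
    by (intro card_mono) auto
  then show ?thesis by (simp add: num_max_def)
qed

lemma num_max_pos:
  assumes "n > 0"
  shows "num_max n X \<omega> > 0"
proof -
  have "max_obs n X \<omega> \<in> (\<lambda>i. X i \<omega>) ` {1..n}"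
    unfolding max_obs_def using assms by (intro Max_in) auto
  then show ?thesis by (auto simp: num_max_def card_gt_0_iff)
qed

text \<open>The binomial terms \<open>(m + 1 choose k) a^k b^(m + 1 - k)\<close>, not normalised, after size biasing and a
  shift by one.\<close>

lemma binomial_size_bias_sum:
  fixes a b :: real
  assumes "a \<ge> 0" "b \<ge> 0"
  shows "(\<Sum>k\<le>Suc m. real k * f k * (real (Suc m choose k) * a ^ k * b ^ (Suc m - k)))
      = real (Suc m) * a * (a + b) ^ m * binomial_mean m (a / (a + b)) (\<lambda>k. f (Suc k))"
proof (cases "a = 0")
  case True
  have zero: "real k * f k * (real (Suc m choose k) * a ^ k * b ^ (Suc m - k)) = 0" for k
    using True by (cases k) auto
  have "(\<Sum>k\<le>Suc m. real k * f k * (real (Suc m choose k) * a ^ k * b ^ (Suc m - k))) = 0"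
    by (simp only: zero sum.neutral_const)
  then show ?thesis using True by simp
next
  case False
  define s where "s = a + b"
  have s: "s > 0" using False assms by (simp add: s_def)
  have q: "a / s \<in> {0..1}" using assms s by (auto simp: s_def)
  have q': "1 - a / s = b / s" using s by (simp add: s_def diff_divide_eq_iff)
  have "(\<Sum>k\<le>Suc m. real k * f k * (real (Suc m choose k) * a ^ k * b ^ (Suc m - k)))
      = (\<Sum>k\<le>m. f (Suc k) * (real (Suc k * (Suc m choose Suc k)) * a ^ Suc k * b ^ (m - k)))"
    by (subst sum.atMost_Suc_shift) (simp add: mult_ac del: binomial_Suc_Suc of_nat_Suc mult_Suc)
  also have "\<dots> = (\<Sum>k\<le>m. real (Suc m) * a * s ^ m *
        (real (m choose k) * (a / s) ^ k * (1 - a / s) ^ (m - k) * f (Suc k)))"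
  proof (intro sum.cong refl)
    fix k assume "k \<in> {..m}"
    then have split: "s ^ m = s ^ k * s ^ (m - k)" by (simp flip: power_add)
    have binom: "Suc k * (Suc m choose Suc k) = Suc m * (m choose k)"
      by (metis Suc_times_binomial_eq mult.commute)
    show "f (Suc k) * (real (Suc k * (Suc m choose Suc k)) * a ^ Suc k * b ^ (m - k))
      = real (Suc m) * a * s ^ m *
        (real (m choose k) * (a / s) ^ k * (1 - a / s) ^ (m - k) * f (Suc k))"
      unfolding binom q' split power_divide using s
      by (simp del: of_nat_Suc mult_Suc)
  qed
  also have "\<dots> = real (Suc m) * a * s ^ m * binomial_mean m (a / s) (\<lambda>k. f (Suc k))"
    unfolding binomial_mean_sum[OF q] by (rule sum_distrib_left[symmetric])
  finally show ?thesis by (simp only: s_def)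
qed

context prob_space
begin

text \<open>The law of the number of maxima, obtained by summing over the value \<open>j\<close> of the maximum and the set \<open>S\<close>
  of positions that attain it. The sum starts at \<open>j = 0\<close>, because the sample is
  only required to be natural-valued here.\<close>

lemma num_max_law:
  fixes X :: "nat \<Rightarrow> 'a \<Rightarrow> nat"
  assumes indep: "indep_vars (\<lambda>_. count_space UNIV) X {1..n}"
    and ident: "\<And>i j. i \<in> {1..n} \<Longrightarrow> j \<in> {1..n} \<Longrightarrow>
           distr M (count_space UNIV) (X i) = distr M (count_space UNIV) (X j)"
    and n: "n > 0" and k: "k > 0"
  defines "p \<equiv> \<lambda>j. prob {\<omega> \<in> space M. X 1 \<omega> = j}" and "G \<equiv> \<lambda>j. prob {\<omega> \<in> space M. X 1 \<omega> < j}"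
  shows "{\<omega> \<in> space M. num_max n X \<omega> = k} \<in> events"
    and "(\<lambda>j. real (n choose k) * p j ^ k * G j ^ (n - k)) sums prob {\<omega> \<in> space M. num_max n X \<omega> = k}"
proof -
  have X: "X i \<in> measurable M (count_space UNIV)" if "i \<in> {1..n}" for i
    using indep that unfolding indep_vars_def by auto
  have same: "prob (X i -` B \<inter> space M) = prob (X 1 -` B \<inter> space M)" if i: "i \<in> {1..n}" for i B
    using arg_cong[OF ident[OF i, of 1], of "\<lambda>D. measure D B"] n X[OF i] X[of 1]
    by (simp add: measure_distr)
  define I where "I = {S. S \<subseteq> {1..n} \<and> card S = k}"
  have fin: "finite I" unfolding I_def by simp
  have I: "S \<subseteq> {1..n}" "S \<noteq> {}" "card S = k" "finite S" if "S \<in> I" for S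
    using that k finite_subset[of S "{1..n}"] by (auto simp: I_def)
  define D where "D j S = (\<Inter>i\<in>{1..n}. X i -` (if i \<in> S then {j} else {..<j}) \<inter> space M)" for j S
  have D_ev: "D j S \<in> events" for j S
    unfolding D_def using n by (intro sets.finite_INT) (auto intro!: measurable_sets[OF X])
  have D_iff: "\<omega> \<in> D j S \<longleftrightarrow> \<omega> \<in> space M \<and> max_obs n X \<omega> = j \<and> {i \<in> {1..n}. X i \<omega> = j} = S"
    if "S \<in> I" for \<omega> j S
    using num_max_eq_cell[OF I(1,2)[OF that], of X \<omega> j] n by (auto simp: D_def)
  have D_prob: "prob (D j S) = p j ^ k * G j ^ (n - k)" if S: "S \<in> I" for j S
  proof -
    have "prob (D j S) = (\<Prod>i\<in>{1..n}. prob (X i -` (if i \<in> S then {j} else {..<j}) \<inter> space M))"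
      unfolding D_def using n by (intro indep_varsD_finite[OF indep]) auto
    also have "\<dots> = (\<Prod>i\<in>{1..n}. if i \<in> S then p j else G j)"
      by (intro prod.cong refl, subst same)
         (auto simp: p_def G_def vimage_def Int_def conj_commute intro!: arg_cong[where f=prob])
    also have "\<dots> = p j ^ card S * G j ^ card ({1..n} - S)"
      using I[OF S] by (subst prod.If_cases) (auto simp: Int_absorb1 Diff_eq)
    also have "card ({1..n} - S) = n - k"
      using I[OF S] by (subst card_Diff_subset) auto
    finally show ?thesis using I(3)[OF S] by simp
  qed
  have layer: "prob (\<Union>S\<in>I. D j S) = real (n choose k) * p j ^ k * G j ^ (n - k)" for j
  proof -
    have "prob (\<Union>S\<in>I. D j S) = (\<Sum>S\<in>I. prob (D j S))"
      using D_ev D_iff by (intro finite_measure_finite_Union fin) (auto simp: disjoint_family_on_def)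
    also have "\<dots> = real (card I) * (p j ^ k * G j ^ (n - k))"
      by (simp add: D_prob)
    also have "card I = n choose k"
      unfolding I_def by (subst n_subsets) auto
    finally show ?thesis by simp
  qed
  have event: "{\<omega> \<in> space M. num_max n X \<omega> = k} = (\<Union>j. \<Union>S\<in>I. D j S)"
  proof (intro equalityI subsetI)
    fix \<omega> assume \<omega>: "\<omega> \<in> {\<omega> \<in> space M. num_max n X \<omega> = k}"
    define S where "S = {i \<in> {1..n}. X i \<omega> = max_obs n X \<omega>}"
    have S: "S \<in> I" using \<omega> by (auto simp: I_def S_def num_max_def)
    then have "\<omega> \<in> D (max_obs n X \<omega>) S" using \<omega> D_iff[OF S] by (simp add: S_def)
    with S show "\<omega> \<in> (\<Union>j. \<Union>S\<in>I. D j S)" by blast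
  next
    fix \<omega> assume "\<omega> \<in> (\<Union>j. \<Union>S\<in>I. D j S)"
    then obtain j S where "S \<in> I" "\<omega> \<in> D j S" by blast
    then show "\<omega> \<in> {\<omega> \<in> space M. num_max n X \<omega> = k}"
      using D_iff[of S \<omega> j] I(3)[of S] by (auto simp: num_max_def)
  qed
  have U_ev: "(\<Union>S\<in>I. D j S) \<in> events" for j
    using D_ev fin by (intro sets.finite_UN) auto
  show "{\<omega> \<in> space M. num_max n X \<omega> = k} \<in> events"
    unfolding event using U_ev by (intro sets.countable_UN) auto
  have "(\<lambda>j. prob (\<Union>S\<in>I. D j S)) sums prob (\<Union>j. \<Union>S\<in>I. D j S)"
    using U_ev D_iff by (intro finite_measure_UNION) (auto simp: disjoint_family_on_def)
  then show "(\<lambda>j. real (n choose k) * p j ^ k * G j ^ (n - k)) sums prob {\<omega> \<in> space M. num_max n X \<omega> = k}"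
    unfolding event layer .
qed

lemma num_max_measurable:
  fixes X :: "nat \<Rightarrow> 'a \<Rightarrow> nat"
  assumes "indep_vars (\<lambda>_. count_space UNIV) X {1..n}"
    and "\<And>i j. i \<in> {1..n} \<Longrightarrow> j \<in> {1..n} \<Longrightarrow>
           distr M (count_space UNIV) (X i) = distr M (count_space UNIV) (X j)"
    and n: "n > 0"
  shows "num_max n X \<in> measurable M (count_space UNIV)"
proof -
  have "num_max n X -` {k} \<inter> space M \<in> events" for k
  proof (cases "k = 0")
    case True
    have nz: "num_max n X \<omega> \<noteq> 0" for \<omega> using num_max_pos[OF n, of X \<omega>] by simp
    have "num_max n X -` {k} \<inter> space M = {}" by (auto simp: True nz)
    then show ?thesis by simp
  next
    case False
    moreover have "num_max n X -` {k} \<inter> space M = {\<omega> \<in> space M. num_max n X \<omega> = k}" by auto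
    ultimately show ?thesis using num_max_law(1)[OF assms, of k] by simp
  qed
  then show ?thesis
    by (subst measurable_count_space_eq2_countable) auto
qed

text \<open>The size-biased number of maxima minus one is mixed binomial with \<open>m\<close> trials, for a sample of size \<open>m + 1\<close>.
  The mixing variable \<open>j\<close> is the value of the maximum under the size-biased law, with weight
  proportional to \<open>p(j) F(j)^m\<close>, and the success probability is \<open>q(j) = p(j) / F(j)\<close>, where \<open>F = p + G\<close>
  is the distribution function. Where \<open>F(j) = 0\<close> the quotient is \<open>0\<close> and so is the weight.
  In \<open>f (K - 1)\<close> no truncation occurs, because \<open>K\<close> is positive.\<close>

lemma num_max_size_bias:
  fixes X :: "nat \<Rightarrow> 'a \<Rightarrow> nat"
  assumes indep: "indep_vars (\<lambda>_. count_space UNIV) X {1..Suc m}"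
    and ident: "\<And>i j. i \<in> {1..Suc m} \<Longrightarrow> j \<in> {1..Suc m} \<Longrightarrow>
           distr M (count_space UNIV) (X i) = distr M (count_space UNIV) (X j)"
  defines "K \<equiv> num_max (Suc m) X"
  obtains \<nu> :: "nat pmf" and q :: "nat \<Rightarrow> real"
  where "\<And>j. q j \<in> {0..1}" and "measure_pmf.expectation \<nu> q > 0"
    and "\<And>f. expectation (\<lambda>\<omega>. real (K \<omega>) * f (K \<omega> - 1))
           = expectation (\<lambda>\<omega>. real (K \<omega>)) * measure_pmf.expectation \<nu> (\<lambda>j. binomial_mean m (q j) f)"
proof -
  define p where "p j = prob {\<omega> \<in> space M. X 1 \<omega> = j}" for j
  define G where "G j = prob {\<omega> \<in> space M. X 1 \<omega> < j}" for j
  define q where "q j = p j / (p j + G j)" for j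
  have nonneg: "p j \<ge> 0" "G j \<ge> 0" for j by (auto simp: p_def G_def)
  have q: "q j \<in> {0..1}" for j
    using nonneg[of j] by (auto simp: q_def divide_le_eq_1)
  have K [measurable]: "K \<in> measurable M (count_space UNIV)"
    unfolding K_def by (rule num_max_measurable[OF indep ident]) auto
  have ev: "{\<omega> \<in> space M. K \<omega> = k} \<in> events" for k by measurable
  define r where "r j = real (Suc m) * p j * (p j + G j) ^ m" for j
  have r0: "r j \<ge> 0" for j using nonneg[of j] by (simp add: r_def)
  have moment: "(\<lambda>j. r j * binomial_mean m (q j) f) sums expectation (\<lambda>\<omega>. real (K \<omega>) * f (K \<omega> - 1))" for f
  proof -
    have "expectation (\<lambda>\<omega>. real (K \<omega>) * f (K \<omega> - 1))
        = expectation (\<lambda>\<omega>. \<Sum>k\<le>Suc m. real k * f (k - 1) * indicator {\<omega> \<in> space M. K \<omega> = k} \<omega>)"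
    proof (intro Bochner_Integration.integral_cong refl)
      fix \<omega> assume \<omega>: "\<omega> \<in> space M"
      have "(\<Sum>k\<le>Suc m. real k * f (k - 1) * indicator {\<omega> \<in> space M. K \<omega> = k} \<omega>)
          = (\<Sum>k\<in>{..Suc m}. if K \<omega> = k then real k * f (k - 1) else 0)"
        using \<omega> by (intro sum.cong) auto
      also have "\<dots> = real (K \<omega>) * f (K \<omega> - 1)"
        using num_max_le[of "Suc m" X \<omega>] by (subst sum.delta') (auto simp: K_def)
      finally show "real (K \<omega>) * f (K \<omega> - 1)
          = (\<Sum>k\<le>Suc m. real k * f (k - 1) * indicator {\<omega> \<in> space M. K \<omega> = k} \<omega>)" by simp
    qed
    also have "\<dots> = (\<Sum>k\<le>Suc m. real k * f (k - 1) * prob {\<omega> \<in> space M. K \<omega> = k})"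
      using ev by (subst Bochner_Integration.integral_sum)
        (auto simp: emeasure_eq_measure Int_absorb1)
    finally have E: "expectation (\<lambda>\<omega>. real (K \<omega>) * f (K \<omega> - 1))
        = (\<Sum>k\<le>Suc m. real k * f (k - 1) * prob {\<omega> \<in> space M. K \<omega> = k})" .
    have "(\<lambda>j. \<Sum>k\<le>Suc m. real k * f (k - 1) * (real (Suc m choose k) * p j ^ k * G j ^ (Suc m - k)))
        sums expectation (\<lambda>\<omega>. real (K \<omega>) * f (K \<omega> - 1))"
      unfolding E
    proof (intro sums_sum)
      fix k
      show "(\<lambda>j. real k * f (k - 1) * (real (Suc m choose k) * p j ^ k * G j ^ (Suc m - k)))
          sums (real k * f (k - 1) * prob {\<omega> \<in> space M. K \<omega> = k})"
        using num_max_law(2)[OF indep ident, of k]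
        by (cases "k = 0") (auto simp: K_def p_def G_def simp del: binomial_Suc_Suc intro!: sums_mult)
    qed
    then show ?thesis
      unfolding binomial_size_bias_sum[OF nonneg] by (simp add: r_def q_def)
  qed
  define \<mu> where "\<mu> = expectation (\<lambda>\<omega>. real (K \<omega>))"
  have bounded: "integrable M (\<lambda>\<omega>. real (K \<omega>))"
  proof (rule integrable_const_bound)
    show "AE \<omega> in M. norm (real (K \<omega>)) \<le> real (Suc m)"
      using num_max_le[of "Suc m" X] by (simp add: K_def del: of_nat_Suc)
  qed measurable
  have "1 = expectation (\<lambda>_. 1 :: real)" by (simp add: prob_space)
  also have "\<dots> \<le> \<mu>"
    unfolding \<mu>_def using num_max_pos[of "Suc m" X]
    by (intro integral_mono bounded) (auto simp: K_def Suc_le_eq)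
  finally have \<mu>: "\<mu> > 0" by simp
  have "r sums \<mu>"
    using moment[of "\<lambda>_. 1"] q by (simp add: \<mu>_def binomial_mean_linear)
  then have w: "(\<lambda>j. r j / \<mu>) sums 1"
    using sums_divide[of r \<mu> \<mu>] \<mu> by simp
  define \<nu> where "\<nu> = embed_pmf (\<lambda>j. r j / \<mu>)"
  have "(\<Sum>j. ennreal (r j / \<mu>)) = 1"
    using w r0 \<mu> by (subst suminf_ennreal_eq[of _ 1]) auto
  then have \<nu>: "pmf \<nu> j = r j / \<mu>" for j
    unfolding \<nu>_def using r0 \<mu> by (intro pmf_embed_pmf) (auto simp: nn_integral_count_space_nat)
  show thesis
  proof (rule that[of q \<nu>])
    show "q j \<in> {0..1}" for j by (rule q)
    have int_q: "integrable \<nu> q" by (rule integrable_pmf_unit_interval[OF q])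
    \<comment> \<open>An atom of \<open>\<nu>\<close> is an atom of the sample law, where \<open>q\<close> is positive.\<close>
    have "measure_pmf.expectation \<nu> q \<noteq> 0"
    proof
      assume "measure_pmf.expectation \<nu> q = 0"
      then have "AE j in \<nu>. q j = 0"
        using q integral_nonneg_eq_0_iff_AE[OF int_q] by auto
      moreover obtain j where j: "j \<in> set_pmf \<nu>" using set_pmf_not_empty[of \<nu>] by auto
      ultimately have "q j = 0" by (simp add: AE_measure_pmf_iff)
      have "r j \<noteq> 0" using j by (auto simp: set_pmf_iff \<nu>)
      then have "p j \<noteq> 0" by (auto simp: r_def)
      then have "p j > 0" using nonneg(1)[of j] by linarith
      then have "q j > 0" unfolding q_def using nonneg(2)[of j] by (intro divide_pos_pos) linarith+
      with \<open>q j = 0\<close> show False by simp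
    qed
    moreover have "measure_pmf.expectation \<nu> q \<ge> 0"
      using q by (intro Bochner_Integration.integral_nonneg) auto
    ultimately show "measure_pmf.expectation \<nu> q > 0" by simp
    fix f :: "nat \<Rightarrow> real"
    from sums_mult[OF pmf_nat_sums_expectation[OF integrable_binomial_mean[where q = q, OF q]], of \<mu> \<nu> m f]
    have "(\<lambda>j. r j * binomial_mean m (q j) f) sums
        (\<mu> * measure_pmf.expectation \<nu> (\<lambda>j. binomial_mean m (q j) f))"
      using \<mu> by (simp add: \<nu>)
    then show "expectation (\<lambda>\<omega>. real (K \<omega>) * f (K \<omega> - 1))
        = expectation (\<lambda>\<omega>. real (K \<omega>)) * measure_pmf.expectation \<nu> (\<lambda>j. binomial_mean m (q j) f)"
      unfolding \<mu>_def by (rule sums_unique2[OF moment[of f]])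
  qed
qed

end

section \<open>The Poisson bound for the number of maxima\<close>

theorem theorem3:
  fixes M :: "'a measure" and N :: "'b measure"
    and X :: "nat \<Rightarrow> 'a \<Rightarrow> nat" and Y :: "'b \<Rightarrow> nat"
    and n :: nat and K :: "'a \<Rightarrow> nat" and EK EK2 EK3 :: real
  defines "K \<equiv> num_max n X"
    and "EK \<equiv> prob_space.expectation M (\<lambda>\<omega>. real (K \<omega>))"
    and "EK2 \<equiv> prob_space.expectation M (\<lambda>\<omega>. falling (K \<omega>) 2)"
    and "EK3 \<equiv> prob_space.expectation M (\<lambda>\<omega>. falling (K \<omega>) 3)"
  assumes "n \<ge> 3"
    and "prob_space M"
    and "prob_space.indep_vars M (\<lambda>_. count_space UNIV) X {1..n}"
    and "\<And>i j. i \<in> {1..n} \<Longrightarrow> j \<in> {1..n} \<Longrightarrow>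
           distr M (count_space UNIV) (X i) = distr M (count_space UNIV) (X j)"
    and "\<And>i \<omega>. i \<in> {1..n} \<Longrightarrow> \<omega> \<in> space M \<Longrightarrow> X i \<omega> > 0"
    and "prob_space N"
    and "Y \<in> measurable N (count_space UNIV)"
    and "distr N (count_space UNIV) Y = measure_pmf (poisson_pmf (EK2 / EK))"
  shows "dTV M K N Y \<le>
      sqrt (EK2 - EK * (EK - 1)) / (2 * EK)
    + sqrt (EK / (4 * EK2))
    + ((real n - 1) * EK3) / ((real n - 2) * EK2)
    - ((real n - 2) * EK2) / ((real n - 1) * EK)"
proof -
  interpret prob_space M by fact
  interpret N: prob_space N by fact
  obtain m where n: "n = Suc (Suc m)" and m: "m > 0"
    using \<open>n \<ge> 3\<close> by (metis One_nat_def Suc_le_D Suc_le_mono less_eq_Suc_le numeral_3_eq_3)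
  have indep: "indep_vars (\<lambda>_. count_space UNIV) X {1..Suc (Suc m)}"
    and ident: "\<And>i j. i \<in> {1..Suc (Suc m)} \<Longrightarrow> j \<in> {1..Suc (Suc m)} \<Longrightarrow>
           distr M (count_space UNIV) (X i) = distr M (count_space UNIV) (X j)"
    using assms unfolding n by blast+
  obtain \<nu> :: "nat pmf" and q :: "nat \<Rightarrow> real"
    where q: "\<And>j. q j \<in> {0..1}" and q_pos: "measure_pmf.expectation \<nu> q > 0"
      and mixture: "\<And>f. expectation (\<lambda>\<omega>. real (K \<omega>) * f (K \<omega> - 1))
             = EK * measure_pmf.expectation \<nu> (\<lambda>j. binomial_mean (Suc m) (q j) f)"
    unfolding K_def EK_def n by (rule num_max_size_bias[OF indep ident]) auto
  define \<theta> where "\<theta> = measure_pmf.expectation \<nu> q"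
  define \<eta> where "\<eta> = measure_pmf.expectation \<nu> (\<lambda>j. (q j)\<^sup>2)"
  have \<theta>: "\<theta> > 0" using q_pos by (simp add: \<theta>_def)
  have K [measurable]: "K \<in> measurable M (count_space UNIV)"
    unfolding K_def n by (rule num_max_measurable[OF indep ident]) auto
  have K_bounds: "1 \<le> K \<omega>" "K \<omega> \<le> n" for \<omega>
    using num_max_pos[of n X \<omega>] num_max_le[of n X \<omega>] n by (auto simp: K_def)
  have int: "integrable M (\<lambda>\<omega>. f (K \<omega>))" for f :: "nat \<Rightarrow> real"
  proof (rule integrable_const_bound)
    show "AE \<omega> in M. norm (f (K \<omega>)) \<le> (\<Sum>i\<le>n. \<bar>f i\<bar>)"
      using K_bounds by (auto intro!: member_le_sum)
  qed measurable
  have "expectation (\<lambda>_. 1 :: real) \<le> EK"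
    unfolding EK_def using K_bounds by (intro integral_mono int) auto
  then have EK: "EK > 0" by (simp add: prob_space)
  have EK2: "EK2 = EK * (real (Suc m) * \<theta>)"
  proof -
    have "EK2 = expectation (\<lambda>\<omega>. real (K \<omega>) * real (K \<omega> - 1))"
      unfolding EK2_def using K_bounds
      by (intro Bochner_Integration.integral_cong) (auto simp: falling_def numeral_2_eq_2 of_nat_diff)
    then show ?thesis
      using mixture[of real] by (simp add: binomial_mean_factorial_moments[OF q] \<theta>_def del: of_nat_Suc)
  qed
  have EK3: "EK3 = EK * (real (Suc m) * real m * \<eta>)"
  proof -
    have "EK3 = expectation (\<lambda>\<omega>. real (K \<omega>) * (real (K \<omega> - 1) * (real (K \<omega> - 1) - 1)))"
      unfolding EK3_def using K_bounds
      by (intro Bochner_Integration.integral_cong) (auto simp: falling_def numeral_3_eq_3 of_nat_diff)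
    also note mixture[of "\<lambda>k. real k * (real k - 1)"]
    also have "(\<lambda>j. binomial_mean (Suc m) (q j) (\<lambda>k. real k * (real k - 1)))
        = (\<lambda>j. real (Suc m) * real m * (q j)\<^sup>2)"
      by (simp add: binomial_mean_factorial_moments[OF q])
    finally show ?thesis by (simp add: \<eta>_def del: of_nat_Suc)
  qed
  define l where "l = real (Suc m) * \<theta>"
  have l: "l > 0" and l_eq: "EK2 / EK = l" using \<theta> EK by (auto simp: l_def EK2)
  have var_K: "variance (\<lambda>\<omega>. real (K \<omega>)) = EK2 - EK * (EK - 1)"
  proof -
    have "EK2 = expectation (\<lambda>\<omega>. (real (K \<omega>))\<^sup>2 - real (K \<omega>))"
      unfolding EK2_def
      by (intro Bochner_Integration.integral_cong) (auto simp: falling_def numeral_2_eq_2 algebra_simps)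
    also have "\<dots> = expectation (\<lambda>\<omega>. (real (K \<omega>))\<^sup>2) - EK"
      using int[of "\<lambda>k. (real k)\<^sup>2"] int[of real] by (simp add: EK_def)
    finally show ?thesis
      using variance_eq[OF int[of real] int[of "\<lambda>k. (real k)\<^sup>2"]]
      by (simp add: algebra_simps power2_eq_square flip: EK_def)
  qed
  have var_q: "measure_pmf.variance \<nu> q = \<eta> - \<theta>\<^sup>2" and "\<eta> \<ge> \<theta>\<^sup>2"
  proof -
    have "(q j)\<^sup>2 \<in> {0..1}" for j using q[of j] by (simp add: power_le_one)
    then have "integrable \<nu> q" "integrable \<nu> (\<lambda>j. (q j)\<^sup>2)"
      using q by (intro integrable_pmf_unit_interval; blast)+
    then show *: "measure_pmf.variance \<nu> q = \<eta> - \<theta>\<^sup>2"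
      unfolding \<eta>_def \<theta>_def by (rule measure_pmf.variance_eq)
    show "\<eta> \<ge> \<theta>\<^sup>2"
      using measure_pmf.variance_positive[of \<nu> q] * by simp
  qed
  have last: "\<theta> + real m * measure_pmf.variance \<nu> q / \<theta>
      \<le> ((real n - 1) * EK3) / ((real n - 2) * EK2) - ((real n - 2) * EK2) / ((real n - 1) * EK)"
  proof -
    have n_diff: "real n - 1 = real (Suc m)" "real n - 2 = real m" by (simp_all add: n)
    have "\<theta> + real m * measure_pmf.variance \<nu> q / \<theta> = real (Suc m) * \<eta> / \<theta> - real m * \<theta> - (\<eta> - \<theta>\<^sup>2) / \<theta>"
      unfolding var_q using \<theta> by (simp add: field_simps power2_eq_square)
    \<comment> \<open>The discarded term is \<open>Var q / \<theta>\<close>.\<close>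
    also have "\<dots> \<le> real (Suc m) * \<eta> / \<theta> - real m * \<theta>"
      using \<theta> \<open>\<eta> \<ge> \<theta>\<^sup>2\<close> by simp
    also have "real (Suc m) * \<eta> / \<theta> = ((real n - 1) * EK3) / ((real n - 2) * EK2)"
      unfolding EK2 EK3 n_diff using \<theta> EK m by (simp del: of_nat_Suc)
    also have "real m * \<theta> = ((real n - 2) * EK2) / ((real n - 1) * EK)"
      unfolding EK2 n_diff using \<theta> EK m by (simp del: of_nat_Suc)
    finally show ?thesis .
  qed
  have middle: "sqrt (EK / (4 * EK2)) = 1 / (2 * sqrt l)"
  proof -
    have "EK / (4 * EK2) = 1 / (4 * l)" using EK l unfolding l_eq[symmetric] by simp
    then show ?thesis by (simp add: real_sqrt_divide real_sqrt_mult)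
  qed
  show ?thesis
    unfolding dTV_def
  proof (rule cSUP_least)
    fix E :: "nat set"
    let ?P = "measure_pmf.prob (poisson_pmf l)"
    have pred: "Suc (K \<omega> - Suc 0) = K \<omega>" for \<omega> using K_bounds(1)[of \<omega>] by simp
    have ev: "{\<omega> \<in> space M. K \<omega> \<in> E} \<in> events" by measurable
    have "expectation (\<lambda>\<omega>. real (K \<omega>) * indicator {\<omega> \<in> space M. K \<omega> \<in> E} \<omega>)
        = expectation (\<lambda>\<omega>. real (K \<omega>) * indicator (Suc -` E) (K \<omega> - 1))"
      by (intro Bochner_Integration.integral_cong) (auto simp: pred split: split_indicator)
    also note mixture
    finally have "expectation (\<lambda>\<omega>. real (K \<omega>) * indicator {\<omega> \<in> space M. K \<omega> \<in> E} \<omega>) / EK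
        = measure_pmf.expectation \<nu> (\<lambda>j. binomial_mean (Suc m) (q j) (indicator (Suc -` E)))"
      using EK by simp
    then have 1: "\<bar>prob {\<omega> \<in> space M. K \<omega> \<in> E}
          - measure_pmf.expectation \<nu> (\<lambda>j. binomial_mean (Suc m) (q j) (indicator (Suc -` E)))\<bar>
        \<le> sqrt (EK2 - EK * (EK - 1)) / (2 * EK)"
      using size_bias_event_bound[OF _ int[of "\<lambda>k. (real k)\<^sup>2"] _ ev] EK var_K
      unfolding EK_def[symmetric] by simp
    have 2: "\<bar>measure_pmf.expectation \<nu> (\<lambda>j. binomial_mean (Suc m) (q j) (indicator (Suc -` E)))
          - ?P (Suc -` E)\<bar> \<le> \<theta> + real m * measure_pmf.variance \<nu> q / \<theta>"
      unfolding l_def \<theta>_def using q_pos by (intro mixed_binomial_poisson_bound q)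
    have 3: "\<bar>?P E - ?P (Suc -` E)\<bar> \<le> 1 / (2 * sqrt l)"
      by (rule poisson_shift_event_bound[OF l])
    have "measure N {\<omega> \<in> space N. Y \<omega> \<in> E} = measure (distr N (count_space UNIV) Y) E"
      using assms(11) by (simp add: measure_distr vimage_def Int_def conj_commute)
    also have "\<dots> = ?P E" using assms(12) l_eq by simp
    finally have Y: "measure N {\<omega> \<in> space N. Y \<omega> \<in> E} = ?P E" .
    show "\<bar>measure M {\<omega> \<in> space M. K \<omega> \<in> E} - measure N {\<omega> \<in> space N. Y \<omega> \<in> E}\<bar>
        \<le> sqrt (EK2 - EK * (EK - 1)) / (2 * EK) + sqrt (EK / (4 * EK2))
          + ((real n - 1) * EK3) / ((real n - 2) * EK2) - ((real n - 2) * EK2) / ((real n - 1) * EK)"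
      using 1 2 3 last unfolding Y middle by linarith
  qed simp
qed

end
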